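(* Let $G$ and $G'$ be graphs, and let $S\subseteq V(G)$, $S'\subseteq V(G')$ with $|S|=|S'|=:s$. Then $\mathcal{E}(G;S,q)=\mathcal{E}(G';S',q)$ (as polynomials in $q$) if and only if for each $0\leq k\leq s$, $$\sum_{W\in\binom{S}{k}}|\mathrm{Obs}(G;W)|=\sum_{W'\in\binom{S'}{k}}|\mathrm{Obs}(G';W')|.$$
   Context: Graphs are finite and simple; $N[X]$ is the closed neighborhood of $X$. Power domination process on a graph $H$ from $T\subseteq V(H)$: set $B:=N[T]$; then, while some $x\in B$ has exactly one vertex $y$ of $N[x]$ outside $B$, add $y$ to $B$. The final set is $\mathrm{Obs}(H;T)$ (with $\mathrm{Obs}(H;\emptyset)=\emptyset$). For $S\subseteq V(H)$, $\mathcal{E}(H;S,q)=\sum_{W\subseteq S}|\mathrm{Obs}(H;W)|\,q^{|S\setminus W|}(1-q)^{|W|}$ (expected number of observed vertices when each sensor fails independently with probability $q$). $\binom{S}{k}$ denotes the set of $k$-element subsets of $S$. *)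

theory Defs
  imports "Graph_Theory.Pair_Digraph" "HOL-Computational_Algebra.Polynomial"
begin

text \<open>A finite simple graph is a \<open>pair_graph\<close>: a finite set of vertices \<open>pverts\<close> with a
  symmetric, irreflexive adjacency relation \<open>parcs\<close> on it.\<close>

definition closed_nbhd :: "'a pair_pre_digraph \<Rightarrow> 'a set \<Rightarrow> 'a set" where
  "closed_nbhd H X = X \<union> {y. \<exists>x\<in>X. (x, y) \<in> parcs H}"

definition pd_step :: "'a pair_pre_digraph \<Rightarrow> 'a set \<Rightarrow> 'a set \<Rightarrow> bool" where
  "pd_step H B B' \<longleftrightarrow> (\<exists>x\<in>B. \<exists>y. closed_nbhd H {x} - B = {y} \<and> B' = insert y B)"

definition pd_final :: "'a pair_pre_digraph \<Rightarrow> 'a set \<Rightarrow> 'a set \<Rightarrow> bool" where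
  "pd_final H T B \<longleftrightarrow> (pd_step H)\<^sup>*\<^sup>* (closed_nbhd H T) B \<and> (\<nexists>B'. pd_step H B B')"

text \<open>The process leaves open which vertex \<open>x\<close> acts next; that the final set nevertheless
  exists and is unique is \<open>pd_final_ex1\<close> below.\<close>

definition Obs :: "'a pair_pre_digraph \<Rightarrow> 'a set \<Rightarrow> 'a set" where
  "Obs H T = (THE B. pd_final H T B)"

text \<open>The expected number of observed vertices, as a polynomial: the indeterminate \<open>q\<close> is
  \<open>[:0, 1:]\<close> and \<open>1 - q\<close> is \<open>[:1, -1:]\<close>.\<close>

definition expected_obs :: "'a pair_pre_digraph \<Rightarrow> 'a set \<Rightarrow> real poly" where
  "expected_obs H S =
     (\<Sum>W\<in>Pow S. of_nat (card (Obs H W)) * [:0, 1:] ^ card (S - W) * [:1, -1:] ^ card W)"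

lemma poly_expected_obs:
  "poly (expected_obs H S) q =
     (\<Sum>W\<in>Pow S. real (card (Obs H W)) * q ^ card (S - W) * (1 - q) ^ card W)"
  by (simp add: expected_obs_def poly_sum)

lemma pd_step_subset_final:
  assumes "(pd_step H)\<^sup>*\<^sup>* A C" "A \<subseteq> B" "\<nexists>B'. pd_step H B B'"
  shows "C \<subseteq> B"
  using assms(1)
proof (induction rule: rtranclp_induct)
  case base
  show ?case by (rule assms(2))
next
  case (step C D)
  then obtain x y where x: "x \<in> C" "closed_nbhd H {x} - C = {y}" "D = insert y C"
    by (auto simp: pd_step_def)
  have "y \<in> B"
  proof (rule ccontr)
    assume "y \<notin> B"
    then have "closed_nbhd H {x} - B = {y}"
      using x step.IH by blast
    then have "pd_step H B (insert y B)"
      using x step.IH by (auto simp: pd_step_def)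
    with assms(3) show False by blast
  qed
  with x step.IH show ?case by blast
qed

lemma pd_final_unique:
  assumes "pd_final H T B" "pd_final H T C"
  shows "B = C"
proof -
  have start: "closed_nbhd H T \<subseteq> D" if "(pd_step H)\<^sup>*\<^sup>* (closed_nbhd H T) D" for D
    using that by (induction rule: rtranclp_induct) (auto simp: pd_step_def)
  from assms show ?thesis
    unfolding pd_final_def by (meson start pd_step_subset_final subset_antisym)
qed

lemma pd_final_ex1:
  assumes "pair_graph H" "T \<subseteq> pverts H"
  shows "\<exists>!B. pd_final H T B"
proof -
  interpret pair_graph H by (rule assms(1))
  have nbhd: "closed_nbhd H X \<subseteq> pverts H" if "X \<subseteq> pverts H" for X
    using that by (auto simp: closed_nbhd_def dest: arc_snd_in_verts)
  have "\<exists>C. (pd_step H)\<^sup>*\<^sup>* B C \<and> (\<nexists>D. pd_step H C D)" if "B \<subseteq> pverts H" for B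
    using that
  proof (induction "card (pverts H - B)" arbitrary: B rule: less_induct)
    case less
    show ?case
    proof (cases "\<exists>D. pd_step H B D")
      case True
      then obtain x y where xy: "x \<in> B" "closed_nbhd H {x} - B = {y}"
        and step: "pd_step H B (insert y B)"
        by (auto simp: pd_step_def)
      have y: "y \<in> pverts H - B"
        using nbhd[of "{x}"] xy less.prems by blast
      then have "card (pverts H - insert y B) < card (pverts H - B)"
        using pair_finite_verts by (intro psubset_card_mono) auto
      moreover have "insert y B \<subseteq> pverts H"
        using y less.prems by blast
      ultimately obtain C where "(pd_step H)\<^sup>*\<^sup>* (insert y B) C" "\<nexists>D. pd_step H C D"
        using less.hyps by blast
      with step show ?thesis
        by (meson converse_rtranclp_into_rtranclp)
    qed auto
  qed
  from this[OF nbhd[OF assms(2)]] pd_final_unique show ?thesis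
    unfolding pd_final_def by metis
qed

lemma Obs_empty: "Obs H {} = {}"
proof -
  have "pd_final H {} {}"
    by (simp add: pd_final_def closed_nbhd_def pd_step_def)
  then show ?thesis
    unfolding Obs_def using pd_final_unique by (metis the_equality)
qed

end

theory Submission
  imports Defs
begin

text \<open>Grouping the sensor sets by size writes the expectation as a combination of the Bernstein
  polynomials \<open>q^(s-k) (1-q)^k\<close> for \<open>k \<le> s\<close>. These are linearly independent: at \<open>q = 0\<close> only the
  one with \<open>k = s\<close> survives, and after removing it, \<open>q\<close> can be cancelled.\<close>

lemma bernstein_independent:
  fixes c :: "nat \<Rightarrow> 'a::idom"
  assumes "(\<Sum>k\<le>n. smult (c k) ([:0, 1:] ^ (n - k) * [:1, -1:] ^ k)) = 0" and "k \<le> n"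
  shows "c k = 0"
  using assms
proof (induction n arbitrary: k)
  case 0
  then show ?case by simp
next
  case (Suc n)
  let ?b = "\<lambda>m k. [:0, 1:] ^ (m - k) * [:1, -1:] ^ k :: 'a poly"
  \<comment> \<open>For \<open>k \<le> n\<close> the exponent \<open>Suc n - k\<close> is
    \<open>Suc (n - k)\<close>, so a factor q splits off; at \<open>k = Suc n\<close> it is
    0.\<close>
  have lower: "smult (c k) (?b (Suc n) k) = [:0, 1:] * smult (c k) (?b n k)" if "k \<le> n" for k
    using that by (simp add: Suc_diff_le mult.assoc)
  have "(\<Sum>k\<le>n. smult (c k) (?b (Suc n) k)) = [:0, 1:] * (\<Sum>k\<le>n. smult (c k) (?b n k))"
    unfolding sum_distrib_left by (intro sum.cong refl lower) simp
  then have split: "[:0, 1:] * (\<Sum>k\<le>n. smult (c k) (?b n k)) + smult (c (Suc n)) ([:1, -1:] ^ Suc n) = 0"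
    using Suc.prems(1) by simp
  \<comment> \<open>At q = 0 the factor \<open>[:0, 1:]\<close> vanishes while
    \<open>[:1, -1:] ^ Suc n\<close> takes the value 1.\<close>
  have top: "c (Suc n) = 0"
    using arg_cong[OF split, of "\<lambda>p. poly p 0"] by simp
  with split have "(\<Sum>k\<le>n. smult (c k) (?b n k)) = 0"
    by simp
  with Suc.IH Suc.prems(2) top show ?case
    by (cases "k = Suc n") auto
qed

text \<open>For finite \<open>S\<close> and \<open>W \<subseteq> S\<close>,
  \<open>card (S - W) = card S - card W\<close>, so the weight of \<open>W\<close> depends only on
  its size.\<close>

lemma expected_obs_by_card:
  assumes "finite S"
  shows "expected_obs H S =
    (\<Sum>k\<le>card S. smult (of_nat (\<Sum>W | W \<subseteq> S \<and> card W = k. card (Obs H W)))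
      ([:0, 1:] ^ (card S - k) * [:1, -1:] ^ k))"
proof -
  let ?b = "\<lambda>k. [:0, 1:] ^ (card S - k) * [:1, -1:] ^ k :: real poly"
  have "expected_obs H S = (\<Sum>W\<in>Pow S. smult (of_nat (card (Obs H W))) (?b (card W)))"
    unfolding expected_obs_def
    using assms by (intro sum.cong refl)
      (simp add: card_Diff_subset finite_subset of_nat_poly mult.assoc)
  \<comment> \<open>The fibres of \<open>card\<close> over \<open>{..card S}\<close> partition
    \<open>Pow S\<close>.\<close>
  also have "\<dots> = (\<Sum>k\<le>card S. \<Sum>W | W \<in> Pow S \<and> card W = k.
      smult (of_nat (card (Obs H W))) (?b (card W)))"
    using assms by (intro sum.group[symmetric]) (auto intro: card_mono)
  also have "\<dots> = (\<Sum>k\<le>card S.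
      smult (of_nat (\<Sum>W | W \<subseteq> S \<and> card W = k. card (Obs H W))) (?b k))"
    by (simp add: smult_sum)
  finally show ?thesis .
qed

theorem theorem3p1:
  fixes G :: "'a pair_pre_digraph" and G' :: "'b pair_pre_digraph"
    and S :: "'a set" and S' :: "'b set" and s :: nat
  assumes "pair_graph G" and "pair_graph G'"
    and "S \<subseteq> pverts G" and "S' \<subseteq> pverts G'"
    and "card S = s" and "card S' = s"
  shows "expected_obs G S = expected_obs G' S' \<longleftrightarrow>
    (\<forall>k\<in>{0..s}. (\<Sum>W | W \<subseteq> S \<and> card W = k. card (Obs G W)) =
                (\<Sum>W' | W' \<subseteq> S' \<and> card W' = k. card (Obs G' W')))"
proof -
  define a where "a k = (\<Sum>W | W \<subseteq> S \<and> card W = k. card (Obs G W))" for k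
  define a' where "a' k = (\<Sum>W' | W' \<subseteq> S' \<and> card W' = k. card (Obs G' W'))" for k
  let ?b = "\<lambda>k. [:0, 1:] ^ (s - k) * [:1, -1:] ^ k :: real poly"
  interpret G: pair_graph G by (rule assms(1))
  interpret G': pair_graph G' by (rule assms(2))
  have fin: "finite S" "finite S'"
    using assms(3,4) G.pair_finite_verts G'.pair_finite_verts by (auto intro: finite_subset)
  have E: "expected_obs G S = (\<Sum>k\<le>s. smult (of_nat (a k)) (?b k))"
    using expected_obs_by_card[OF fin(1)] assms(5) by (simp only: a_def)
  have E': "expected_obs G' S' = (\<Sum>k\<le>s. smult (of_nat (a' k)) (?b k))"
    using expected_obs_by_card[OF fin(2)] assms(6) by (simp only: a'_def)
  have "expected_obs G S = expected_obs G' S' \<longleftrightarrow> (\<forall>k\<in>{0..s}. a k = a' k)"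
  proof
    assume "expected_obs G S = expected_obs G' S'"
    \<comment> \<open>The coefficients are subtracted in the reals, where subtraction is not
      truncated; once they vanish, injectivity of \<open>of_nat\<close> gives equality of the
      natural numbers.\<close>
    then have "(\<Sum>k\<le>s. smult (of_nat (a k) - of_nat (a' k)) (?b k)) = 0"
      by (simp only: E E' smult_diff_left sum_subtractf right_minus_eq)
    from bernstein_independent[OF this] show "\<forall>k\<in>{0..s}. a k = a' k"
      by simp
  next
    assume "\<forall>k\<in>{0..s}. a k = a' k"
    then show "expected_obs G S = expected_obs G' S'"
      unfolding E E' by (intro sum.cong) auto
  qed
  then show ?thesis
    by (simp only: a_def a'_def)
qed

end
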